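(* Let $n$ be an odd perfect number, written in Euler's form $n=\pi^{\alpha}N^{2}$, where $\pi$ is prime, $\alpha$ and $N$ are positive integers, $\gcd(\pi,N)=1$ and $\pi\equiv\alpha\equiv 1\pmod 4$. Let $\omega(n)$ be the number of distinct prime factors of $n$, and let $A$ be the positive integer with $N^{2}=A\,\frac{\sigma(\pi^{\alpha})}{2}$ and $\sigma(N^{2})=A\pi^{\alpha}$. Consider the propositions $$a:\ A=1,\qquad \neg a:\ A>1,\qquad b:\ \alpha\ge\omega(n)-1,\qquad c:\ N^{2}>\tfrac12\pi^{\alpha},\qquad d:\ N^{2}>\tfrac32\pi^{\alpha}.$$ Then $$(\neg a\land d)\ \lor\ (a\land b\land c)\ \lor\ (b\land c\land d)$$ holds.
   Context: $\sigma(m)$ is the sum of the positive divisors of $m$; a positive integer $n$ is perfect if $\sigma(n)=2n$. By a classical theorem of Euler, every odd perfect number has the form $n=\pi^{\alpha}N^{2}$ with $\pi$ prime, $\gcd(\pi,N)=1$ and $\pi\equiv\alpha\equiv1\pmod 4$. Here $\pi$ denotes a prime number, not the constant $3.14\ldots$ For an odd perfect number so written, the number $A=\sigma(N^{2})/\pi^{\alpha}$ is a positive integer and satisfies $N^{2}=A\,\sigma(\pi^{\alpha})/2$. *)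

theory Defs
  imports Complex_Main "HOL-Number_Theory.Number_Theory"
begin

definition divisor_sigma :: "nat \<Rightarrow> nat" where
  "divisor_sigma m = (\<Sum>d | d dvd m. d)"

definition perfect :: "nat \<Rightarrow> bool" where
  "perfect n \<longleftrightarrow> n > 0 \<and> divisor_sigma n = 2 * n"

definition omega :: "nat \<Rightarrow> nat" where
  "omega n = card (prime_factors n)"

end

theory Submission
  imports Defs
begin

text \<open>
  Since \<open>n\<close> is odd, so are \<open>p\<close> and \<open>N\<close>, and everything rests on the size of \<open>A\<close> in
  \<open>2 * N\<^sup>2 = A * divisor_sigma (p ^ \<alpha>)\<close>.

  If \<open>A > 1\<close>, then in fact \<open>A \<ge> 3\<close>, because \<open>A\<close> is odd: \<open>p ^ \<alpha>\<close> has \<open>\<alpha> + 1\<close> divisors, all odd,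
  and \<open>\<alpha>\<close> is odd, so \<open>divisor_sigma (p ^ \<alpha>)\<close> is even (\<open>even_divisor_sigma_odd_primepow\<close>); an
  even \<open>A\<close> would make \<open>2 * N\<^sup>2\<close> divisible by 4. Together with \<open>divisor_sigma (p ^ \<alpha>) > p ^ \<alpha>\<close>
  this gives \<open>N\<^sup>2 > 3/2 * p ^ \<alpha>\<close>, which is the first alternative.

  If \<open>A = 1\<close>, the same strict inequality gives \<open>N\<^sup>2 > 1/2 * p ^ \<alpha>\<close>. Moreover
  \<open>divisor_sigma (N\<^sup>2) = p ^ \<alpha>\<close> is a product of one factor for each prime of \<open>N\<close>, by
  multiplicativity (\<open>divisor_sigma_mult_coprime\<close>). Each factor exceeds 1, so it uses up at least
  one of the \<open>\<alpha>\<close> prime factors of \<open>p ^ \<alpha>\<close>; hence \<open>N\<close> has at most \<open>\<alpha>\<close> primes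
  (\<open>omega_le_size_prime_factorization_divisor_sigma\<close>) and \<open>n\<close> at most \<open>\<alpha> + 1\<close>. This is the
  second alternative.
\<close>

lemma divisor_sigma_gt_self:
  assumes "m > 1"
  shows "divisor_sigma m > m"
proof -
  have "(\<Sum>d\<in>{1, m}. d) \<le> divisor_sigma m"
    unfolding divisor_sigma_def using assms by (intro sum_mono2) auto
  then show ?thesis using assms by simp
qed

text \<open>Each divisor of \<open>a * b\<close> splits into a divisor of \<open>a\<close> and a divisor of \<open>b\<close>; coprimality
  makes the splitting unique, so the sum over divisors of \<open>a * b\<close> is a product of two sums.\<close>

lemma divisor_sigma_mult_coprime:
  assumes "coprime a b"
  shows "divisor_sigma (a * b) = divisor_sigma a * divisor_sigma b"
proof -
  have left_unique: "d dvd d'"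
    if "d dvd a" "e' dvd b" "d * e = d' * e'" for d d' e e' :: nat
  proof -
    have "coprime d e'" using that assms by (blast intro: coprime_divisors)
    moreover have "d dvd d' * e'" using that(3) by (metis dvd_triv_left)
    ultimately show ?thesis by (simp add: coprime_dvd_mult_left_iff)
  qed
  have right_unique: "e dvd e'"
    if "d' dvd a" "e dvd b" "d * e = d' * e'" for d d' e e' :: nat
  proof -
    have "coprime e d'" using that assms by (metis coprime_commute coprime_divisors)
    moreover have "e dvd d' * e'" using that(3) by (metis dvd_triv_right)
    ultimately show ?thesis by (simp add: coprime_dvd_mult_right_iff)
  qed
  have inj: "inj_on (\<lambda>(d, e). d * e) ({d. d dvd a} \<times> {e. e dvd b})"
  proof (rule inj_onI, clarsimp)
    fix d e d' e' :: nat
    assume "d dvd a" "e dvd b" "d' dvd a" "e' dvd b" "d * e = d' * e'"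
    then show "d = d' \<and> e = e'"
      using left_unique[of d e' e d'] left_unique[of d' e e' d]
        right_unique[of d' e d e'] right_unique[of d e' d' e]
      by (auto intro: dvd_antisym)
  qed
  have image: "(\<lambda>(d, e). d * e) ` ({d. d dvd a} \<times> {e. e dvd b}) = {d. d dvd a * b}"
  proof (intro equalityI subsetI)
    fix x assume "x \<in> {d. d dvd a * b}"
    then obtain d e where "x = d * e" "d dvd a" "e dvd b"
      using division_decomp[of x a b] by auto
    then show "x \<in> (\<lambda>(d, e). d * e) ` ({d. d dvd a} \<times> {e. e dvd b})" by force
  qed (auto intro: mult_dvd_mono)
  have "divisor_sigma (a * b) = (\<Sum>(d, e)\<in>{d. d dvd a} \<times> {e. e dvd b}. d * e)"
    unfolding divisor_sigma_def image[symmetric]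
    by (subst sum.reindex[OF inj]) (auto simp: case_prod_beta)
  then show ?thesis
    by (simp add: divisor_sigma_def sum_product sum.cartesian_product)
qed

text \<open>Induction over the prime powers of \<open>m\<close>: splitting off one of them removes one prime from \<open>m\<close>
  and a factor greater than 1, hence at least one prime factor, from \<open>divisor_sigma m\<close>.\<close>

lemma omega_le_size_prime_factorization_divisor_sigma:
  assumes "m > 0"
  shows "omega m \<le> size (prime_factorization (divisor_sigma m))"
  using assms
proof (induction m rule: less_induct)
  case (less m)
  show ?case
  proof (cases "m = 1")
    case True
    then show ?thesis by (simp add: omega_def)
  next
    case False
    with less.prems have "m \<noteq> 0" "\<not> is_unit m" by auto
    then obtain q k m' where q: "prime q" "\<not> q dvd m'" "k > 0" "m = q ^ k * m'"
      by (rule divide_out_primepow)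
    have "q ^ k > 1" using q by (intro one_less_power prime_gt_1_nat)
    have "m' > 0" using less.prems q by auto
    then have "m' < m" using \<open>q ^ k > 1\<close> q by simp
    with less.IH \<open>m' > 0\<close>
    have IH: "omega m' \<le> size (prime_factorization (divisor_sigma m'))" by blast
    have "coprime (q ^ k) m'" using q by (simp add: prime_imp_coprime)
    then have sigma: "divisor_sigma m = divisor_sigma (q ^ k) * divisor_sigma m'"
      using q by (simp add: divisor_sigma_mult_coprime)
    have "prime_factors m = insert q (prime_factors m')"
      using q \<open>m' > 0\<close>
      by (simp add: prime_factors_product prime_factorization_prime_power)
    then have "omega m \<le> Suc (omega m')"
      by (simp add: omega_def card_insert_if)
    moreover have "divisor_sigma (q ^ k) > 1"
      using divisor_sigma_gt_self[OF \<open>q ^ k > 1\<close>] \<open>q ^ k > 1\<close> by linarith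
    then have "size (prime_factorization (divisor_sigma (q ^ k))) > 0"
      by (simp add: prime_factorization_empty_iff flip: nonempty_has_size)
    moreover have "divisor_sigma m' > 0"
      using divisor_sigma_gt_self[of m'] \<open>m' > 0\<close>
      by (cases "m' = 1") (auto simp: divisor_sigma_def)
    ultimately show ?thesis
      using IH sigma \<open>divisor_sigma (q ^ k) > 1\<close> by (simp add: prime_factorization_mult)
  qed
qed

lemma even_divisor_sigma_odd_primepow:
  assumes "prime p" "odd p" "odd k"
  shows "even (divisor_sigma (p ^ k))"
proof -
  have divisors: "{d. d dvd p ^ k} = (\<lambda>i. p ^ i) ` {..k}"
    using assms(1) by (auto simp: divides_primepow_nat)
  have "inj_on (\<lambda>i. p ^ i) {..k}"
    using assms(1) by (auto intro!: inj_onI dest: prime_gt_1_nat)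
  then have "divisor_sigma (p ^ k) = (\<Sum>i\<le>k. p ^ i)"
    by (simp add: divisor_sigma_def divisors sum.reindex)
  then show ?thesis
    using assms by (simp add: even_sum_iff)
qed

theorem theorem2p1:
  fixes n p \<alpha> N A :: nat
  assumes "odd n" and "perfect n"
    and "n = p ^ \<alpha> * N\<^sup>2"
    and "prime p" and "\<alpha> > 0" and "N > 0" and "coprime p N"
    and "[p = \<alpha>] (mod 4)" and "[\<alpha> = 1] (mod 4)"
    and "A > 0"
    and "real (N\<^sup>2) = real A * (real (divisor_sigma (p ^ \<alpha>)) / 2)"
    and "divisor_sigma (N\<^sup>2) = A * p ^ \<alpha>"
  shows "let a = (A = 1);
             not_a = (A > 1);
             b = (int \<alpha> \<ge> int (omega n) - 1);
             c = (real (N\<^sup>2) > 1 / 2 * real (p ^ \<alpha>));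
             d = (real (N\<^sup>2) > 3 / 2 * real (p ^ \<alpha>))
         in (not_a \<and> d) \<or> (a \<and> b \<and> c) \<or> (b \<and> c \<and> d)"
proof -
  have "p ^ \<alpha> > 1" using assms(4,5) by (intro one_less_power prime_gt_1_nat)
  note sigma_gt = divisor_sigma_gt_self[OF this]
  have "real (2 * N\<^sup>2) = real (A * divisor_sigma (p ^ \<alpha>))" using assms(11) by simp
  then have double: "2 * N\<^sup>2 = A * divisor_sigma (p ^ \<alpha>)" by (simp only: of_nat_eq_iff)
  have "odd p" "odd N" using assms(1,3,5) by auto
  have "odd \<alpha>"
    using assms(9) unfolding cong_def by presburger
  show ?thesis
  proof (cases "A = 1")
    case True
    have "p ^ \<alpha> < 2 * N\<^sup>2" using sigma_gt double True by simp
    then have c: "real (N\<^sup>2) > 1 / 2 * real (p ^ \<alpha>)" by linarith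
    have "omega (N\<^sup>2) \<le> \<alpha>"
      using omega_le_size_prime_factorization_divisor_sigma[of "N\<^sup>2"] assms True
      by (simp add: prime_factorization_prime_power)
    moreover have "prime_factors n = insert p (prime_factors (N\<^sup>2))"
      using assms by (simp add: prime_factors_product prime_factorization_prime_power)
    then have "omega n \<le> Suc (omega (N\<^sup>2))"
      by (simp add: omega_def card_insert_if)
    ultimately show ?thesis using c True by (simp add: Let_def)
  next
    case False
    have "odd A"
    proof
      assume "even A"
      with even_divisor_sigma_odd_primepow[OF assms(4) \<open>odd p\<close> \<open>odd \<alpha>\<close>]
      have "2 * 2 dvd 2 * N\<^sup>2" unfolding double by (intro mult_dvd_mono)
      then show False using \<open>odd N\<close> by (simp only: dvd_times_left_cancel_iff) simp
    qed
    with False have "A \<ge> 3" by presburger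
    then have "3 * divisor_sigma (p ^ \<alpha>) \<le> 2 * N\<^sup>2" by (simp add: double)
    with sigma_gt have "3 * p ^ \<alpha> < 2 * N\<^sup>2" by linarith
    then have "real (N\<^sup>2) > 3 / 2 * real (p ^ \<alpha>)" by linarith
    then show ?thesis using \<open>A \<ge> 3\<close> by (simp add: Let_def)
  qed
qed

end
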